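(* Let $G=G(n,\tfrac12)$ be the Erdős–Rényi random graph. Then asymptotically almost surely (i.e. with probability tending to $1$ as $n\to\infty$), \[\sqrt{s^+(G)} \le \sum_{v\in V(G)}\frac{c(v)-1}{c(v)}.\]
   Context: $G(n,p)$ is the random graph on $n$ labelled vertices in which each pair is an edge independently with probability $p$. $s^+(G)=\sum_{\lambda_i>0}\lambda_i^2$, summing over the positive adjacency eigenvalues. For a vertex $v$, $c(v)$ is the order of the largest clique of $G$ containing $v$. *)

theory Defs
  imports "HOL-Probability.Product_PMF" "Jordan_Normal_Form.Char_Poly"
begin

text \<open>A simple graph on the labelled vertex set \<open>{..<n}\<close> is represented by its set of edges,
  each edge being a two-element subset of \<open>{..<n}\<close>.\<close>

definition vertex_pairs :: "nat \<Rightarrow> nat set set" where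
  "vertex_pairs n = {e. e \<subseteq> {..<n} \<and> card e = 2}"

definition random_graph :: "nat \<Rightarrow> real \<Rightarrow> nat set set pmf" where
  "random_graph n p =
     map_pmf (\<lambda>f. {e \<in> vertex_pairs n. f e})
       (Pi_pmf (vertex_pairs n) False (\<lambda>_. bernoulli_pmf p))"

definition adjacency_mat :: "nat \<Rightarrow> nat set set \<Rightarrow> real mat" where
  "adjacency_mat n E = mat n n (\<lambda>(i, j). if {i, j} \<in> E then 1 else 0)"

text \<open>Eigenvalues count with multiplicity. The matrix is real symmetric, so all its eigenvalues
  are real and algebraic and geometric multiplicities agree.\<close>

definition s_plus :: "nat \<Rightarrow> nat set set \<Rightarrow> real" where
  "s_plus n E =
     (\<Sum>x | eigenvalue (adjacency_mat n E) x \<and> x > 0.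
        real (Polynomial.order x (char_poly (adjacency_mat n E))) * x\<^sup>2)"

definition is_clique :: "nat \<Rightarrow> nat set set \<Rightarrow> nat set \<Rightarrow> bool" where
  "is_clique n E K \<longleftrightarrow> K \<subseteq> {..<n} \<and> (\<forall>u\<in>K. \<forall>v\<in>K. u \<noteq> v \<longrightarrow> {u, v} \<in> E)"

definition clique_order :: "nat \<Rightarrow> nat set set \<Rightarrow> nat \<Rightarrow> nat" where
  "clique_order n E v = Max {card K | K. is_clique n E K \<and> v \<in> K}"

end

theory Submission
  imports Defs "HOL-Probability.Hoeffding" "HOL-Real_Asymp.Real_Asymp"
    "Jordan_Normal_Form.Schur_Decomposition"
begin

text \<open>
  Since all eigenvalues are real, \<open>s\<^sup>+\<close> is at most the trace of the squared adjacency matrix, i.e. twice the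
  number of edges. By Hoeffding's inequality the latter is below \<open>9/16 * n\<^sup>2\<close> asymptotically almost
  surely, so \<open>sqrt s\<^sup>+ \<le> 3/4 * n\<close>. On the other hand, the vertices other than \<open>v\<close> contain about \<open>n/3\<close>
  disjoint triples, each of which independently forms a 4-clique with \<open>v\<close> with probability
  \<open>1/64\<close>; a union bound over \<open>v\<close> shows that a.a.s. \<open>c(v) \<ge> 4\<close> for every \<open>v\<close>, so that every
  summand \<open>(c(v) - 1) / c(v)\<close> is at least \<open>3/4\<close>.
\<close>

unbundle no vec_syntax

section \<open>The spectral bound\<close>

definition mat_trace :: "'a :: comm_monoid_add mat \<Rightarrow> 'a" where
  "mat_trace A = (\<Sum>i<dim_row A. A $$ (i, i))"

lemma mat_trace_mult:
  fixes A B :: "'a :: semiring_0 mat"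
  assumes "A \<in> carrier_mat n m" "B \<in> carrier_mat m n"
  shows "mat_trace (A * B) = (\<Sum>i<n. \<Sum>j<m. A $$ (i, j) * B $$ (j, i))"
  using assms by (auto simp: mat_trace_def scalar_prod_def atLeast0LessThan intro!: sum.cong)

lemma mat_trace_mult_comm:
  fixes A B :: "'a :: comm_semiring_0 mat"
  assumes "A \<in> carrier_mat n m" "B \<in> carrier_mat m n"
  shows "mat_trace (A * B) = mat_trace (B * A)"
  using assms by (subst (1 2) mat_trace_mult) (auto simp: mult.commute intro: sum.swap)

text \<open>Cyclicity of the trace turns \<open>P * (B * Q)\<close> into \<open>(B * Q) * P\<close>,
  and \<open>Q * P\<close> is the identity.\<close>

lemma mat_trace_similar:
  fixes A B :: "'a :: comm_semiring_1 mat"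
  assumes A: "A \<in> carrier_mat n n" and sim: "similar_mat_wit A B P Q"
  shows "mat_trace A = mat_trace B"
proof -
  note w = similar_mat_witD2[OF A sim]
  have "mat_trace A = mat_trace (P * (B * Q))"
    using w assoc_mult_mat[of P n n B n Q n] by simp
  also have "\<dots> = mat_trace ((B * Q) * P)"
    using w by (intro mat_trace_mult_comm[of _ n n]) auto
  also have "(B * Q) * P = B"
    using w assoc_mult_mat[of B n n Q n P n] by simp
  finally show ?thesis .
qed

section \<open>Real spectrum of symmetric matrices\<close>

text \<open>For an eigenvector \<open>v\<close>, the quadratic form \<open>q\<close> of
  \<open>A\<close> at \<open>v\<close> equals \<open>k\<close> times the squared norm
  \<open>s > 0\<close>. Being Hermitian makes \<open>q\<close> its own conjugate, so
  \<open>k\<close> is too.\<close>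

lemma hermitian_eigenvalue_real:
  fixes A :: "complex mat"
  assumes A: "A \<in> carrier_mat n n"
    and herm: "\<And>i j. i < n \<Longrightarrow> j < n \<Longrightarrow> cnj (A $$ (i, j)) = A $$ (j, i)"
    and "eigenvalue A k"
  shows "k \<in> \<real>"
proof -
  from \<open>eigenvalue A k\<close> obtain v where v: "v \<in> carrier_vec n" "v \<noteq> 0\<^sub>v n"
      and Av: "A *\<^sub>v v = k \<cdot>\<^sub>v v"
    using A unfolding eigenvalue_def eigenvector_def by auto
  have ev: "(\<Sum>j<n. A $$ (i, j) * v $ j) = k * v $ i" if "i < n" for i
  proof -
    have "(A *\<^sub>v v) $ i = (k \<cdot>\<^sub>v v) $ i" using Av by simp
    thus ?thesis using that A v by (simp add: scalar_prod_def atLeast0LessThan)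
  qed
  define q where "q = (\<Sum>i<n. \<Sum>j<n. cnj (v $ i) * A $$ (i, j) * v $ j)"
  define s where "s = (\<Sum>i<n. (cmod (v $ i))\<^sup>2)"
  have "q = (\<Sum>i<n. cnj (v $ i) * (k * v $ i))"
    unfolding q_def by (intro sum.cong refl) (simp add: ev[symmetric] sum_distrib_left mult.assoc)
  also have "\<dots> = k * complex_of_real s"
    unfolding s_def of_real_sum sum_distrib_left
    by (intro sum.cong refl) (simp add: complex_norm_square[symmetric] mult_ac)
  finally have q: "q = k * of_real s" .
  have "cnj q = (\<Sum>i<n. \<Sum>j<n. v $ i * A $$ (j, i) * cnj (v $ j))"
    unfolding q_def by (simp add: herm)
  also have "\<dots> = (\<Sum>j<n. \<Sum>i<n. v $ i * A $$ (j, i) * cnj (v $ j))"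
    by (rule sum.swap)
  also have "\<dots> = q"
    unfolding q_def by (simp add: mult_ac)
  finally have "cnj q = q" .
  obtain i where i: "i < n" "v $ i \<noteq> 0"
    using v by (metis carrier_vecD eq_vecI index_zero_vec)
  have "s > 0"
    unfolding s_def by (rule sum_pos2[of _ i]) (use i in auto)
  with q \<open>cnj q = q\<close> have "cnj k = k" by simp
  thus ?thesis by (simp add: Reals_cnj_iff)
qed

text \<open>The polynomial splits over the complex numbers and its roots there are real; injectivity
  of the embedding of polynomials brings the factorization back to the reals. The Schur
  decomposition takes its eigenvalues as such a list.\<close>

lemma symmetric_char_poly_splits:
  fixes A :: "real mat"
  assumes A: "A \<in> carrier_mat n n"
    and sym: "\<And>i j. i < n \<Longrightarrow> j < n \<Longrightarrow> A $$ (i, j) = A $$ (j, i)"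
  obtains rs where "char_poly A = (\<Prod>r\<leftarrow>rs. [:- r, 1:])"
proof -
  interpret hom: map_poly_inj_idom_hom complex_of_real ..
  let ?C = "map_mat complex_of_real A"
  have C: "?C \<in> carrier_mat n n" using A by simp
  obtain as where as: "char_poly ?C = (\<Prod>a\<leftarrow>as. [:- a, 1:])"
    using char_poly_factorized[OF C] by blast
  have real: "a \<in> \<real>" if "a \<in> set as" for a
  proof (rule hermitian_eigenvalue_real[OF C])
    show "eigenvalue ?C a"
      using that unfolding eigenvalue_root_char_poly[OF C] as
      by (auto simp: poly_prod_list prod_list_zero_iff)
  qed (use A sym in auto)
  define rs where "rs = map Re as"
  have "as = map complex_of_real rs"
    using real by (auto simp: rs_def o_def intro!: map_idI[symmetric])
  hence "map_poly complex_of_real (char_poly A) = (\<Prod>r\<leftarrow>rs. [:- complex_of_real r, 1:])"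
    using as of_real_hom.char_poly_hom[OF A, where ?'a = complex] by (simp add: o_def)
  also have "\<dots> = map_poly complex_of_real (\<Prod>r\<leftarrow>rs. [:- r, 1:])"
  proof (induction rs)
    case (Cons r rs)
    show ?case
      unfolding list.map prod_list.Cons Cons.IH hom.hom_mult by simp
  qed simp
  finally have "char_poly A = (\<Prod>r\<leftarrow>rs. [:- r, 1:])"
    by (rule hom.injectivity)
  thus ?thesis by (rule that)
qed

section \<open>Multiplicities and the trace of the square\<close>

text \<open>Turns the algebraic multiplicities in \<open>s_plus\<close> into counts in the list of
  roots.\<close>

lemma order_prod_linear_factors:
  fixes x :: "'a :: idom"
  shows "Polynomial.order x (\<Prod>a\<leftarrow>as. [:- a, 1:]) = count_list as x"
proof (induction as)
  case (Cons a as)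
  have "(\<Prod>b\<leftarrow>as. [:- b, 1:]) \<noteq> 0" by (auto simp: prod_list_zero_iff)
  moreover have "Polynomial.order x [:- a, 1:] = (if a = x then 1 else 0)"
    using order_power_n_n[of a 1] by (auto intro: order_0I)
  ultimately show ?case
    using Cons.IH by (simp add: order_mult del: mult_pCons_left)
qed (simp add: order_0I)

lemma sum_count_list:
  fixes f :: "'a \<Rightarrow> 'b :: comm_semiring_1"
  assumes "finite X" "set xs \<subseteq> X"
  shows "(\<Sum>x\<in>X. of_nat (count_list xs x) * f x) = (\<Sum>x\<leftarrow>xs. f x)"
  using assms(2)
proof (induction xs)
  case (Cons a xs)
  have "(\<Sum>x\<in>X. of_nat (count_list (a # xs) x) * f x) =
      (\<Sum>x\<in>X. (if x = a then f x else 0) + of_nat (count_list xs x) * f x)"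
    by (intro sum.cong refl) (auto simp: algebra_simps)
  also have "\<dots> = f a + (\<Sum>x\<leftarrow>xs. f x)"
    using Cons assms(1) by (simp add: sum.distrib)
  finally show ?case by simp
qed simp

text \<open>\<open>A\<close> is similar to an upper triangular \<open>B\<close> with diagonal
  \<open>rs\<close>, and the same \<open>P\<close>, \<open>Q\<close> carry \<open>A * A\<close> to
  \<open>B * B\<close>, whose diagonal holds the squares of the roots.\<close>

lemma sum_sq_roots_eq_trace:
  fixes A :: "real mat"
  assumes A: "A \<in> carrier_mat n n" and cp: "char_poly A = (\<Prod>r\<leftarrow>rs. [:- r, 1:])"
  shows "(\<Sum>r\<leftarrow>rs. r\<^sup>2) = mat_trace (A * A)"
proof -
  obtain B P Q where "schur_decomposition A rs = (B, P, Q)"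
    by (cases "schur_decomposition A rs") auto
  from schur_decomposition[OF A cp this] have sim: "similar_mat_wit A B P Q"
      and ut: "upper_triangular B" and diag: "diag_mat B = rs" by auto
  note w = similar_mat_witD2[OF A sim]
  have B: "B \<in> carrier_mat n n" using w by simp
  have "similar_mat_wit (A * A) (B * B) P Q"
    using similar_mat_wit_pow[OF sim, of 2] A B by (simp add: numeral_2_eq_2)
  hence "mat_trace (A * A) = mat_trace (B * B)"
    using A by (intro mat_trace_similar[of _ n]) auto
  also have "\<dots> = (\<Sum>i<n. \<Sum>j<n. B $$ (i, j) * B $$ (j, i))"
    by (rule mat_trace_mult[OF B B])
  \<comment> \<open>For distinct \<open>i\<close> and \<open>j\<close>, one of the two factors lies
    below the diagonal and vanishes.\<close>
  also have "\<dots> = (\<Sum>i<n. \<Sum>j<n. if j = i then (B $$ (i, i))\<^sup>2 else 0)"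
  proof (intro sum.cong refl)
    fix i j assume "i \<in> {..<n}" "j \<in> {..<n}"
    thus "B $$ (i, j) * B $$ (j, i) = (if j = i then (B $$ (i, i))\<^sup>2 else 0)"
      using upper_triangularD[OF ut, of i j] upper_triangularD[OF ut, of j i] B
      by (cases i j rule: linorder_cases) (auto simp: power2_eq_square)
  qed
  also have "\<dots> = (\<Sum>i<n. (B $$ (i, i))\<^sup>2)"
    by simp
  also have "\<dots> = (\<Sum>r\<leftarrow>diag_mat B. r\<^sup>2)"
    using B by (simp add: diag_mat_def o_def interv_sum_list_conv_sum_set_nat atLeast0LessThan)
  finally show ?thesis by (simp add: diag)
qed

text \<open>All roots are real, so extending the sum from the positive ones to all of them only adds
  nonnegative squares.\<close>

lemma s_plus_le_trace:
  "s_plus n E \<le> mat_trace (adjacency_mat n E * adjacency_mat n E)"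
proof -
  let ?A = "adjacency_mat n E"
  have A: "?A \<in> carrier_mat n n" by (simp add: adjacency_mat_def)
  have sym: "?A $$ (i, j) = ?A $$ (j, i)" if "i < n" "j < n" for i j
    using that by (simp add: adjacency_mat_def insert_commute)
  obtain rs where cp: "char_poly ?A = (\<Prod>r\<leftarrow>rs. [:- r, 1:])"
    using symmetric_char_poly_splits[OF A sym] .
  have ev: "eigenvalue ?A x \<longleftrightarrow> x \<in> set rs" for x
    unfolding eigenvalue_root_char_poly[OF A] cp by (auto simp: poly_prod_list prod_list_zero_iff)
  have "s_plus n E = (\<Sum>x | x \<in> set rs \<and> x > 0. real (count_list rs x) * x\<^sup>2)"
    unfolding s_plus_def cp ev order_prod_linear_factors ..
  also have "\<dots> \<le> (\<Sum>x\<in>set rs. real (count_list rs x) * x\<^sup>2)"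
    by (intro sum_mono2) auto
  also have "\<dots> = (\<Sum>r\<leftarrow>rs. r\<^sup>2)"
    by (rule sum_count_list) auto
  also have "\<dots> = mat_trace (?A * ?A)"
    by (rule sum_sq_roots_eq_trace[OF A cp])
  finally show ?thesis .
qed

section \<open>From the trace to the number of edges\<close>

lemma finite_vertex_pairs: "finite (vertex_pairs n)"
  by (rule finite_subset[of _ "Pow {..<n}"]) (auto simp: vertex_pairs_def)

lemma card_vertex_pairs: "card (vertex_pairs n) = n choose 2"
  unfolding vertex_pairs_def using n_subsets[of "{..<n}" 2] by simp

text \<open>The trace of the squared adjacency matrix counts ordered pairs \<open>(i, j)\<close>
  with \<open>{i, j}\<close> an edge, and each edge \<open>e\<close> has at most two orderings,
  collected in \<open>?S e\<close>.\<close>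

lemma s_plus_le_twice_edges:
  assumes E: "E \<subseteq> vertex_pairs n"
  shows "s_plus n E \<le> 2 * real (card E)"
proof -
  let ?A = "adjacency_mat n E" and ?S = "\<lambda>e. {(i, j) \<in> {..<n} \<times> {..<n}. {i, j} = e}"
  have A: "?A \<in> carrier_mat n n" by (simp add: adjacency_mat_def)
  have finE: "finite E" using finite_subset[OF E finite_vertex_pairs] .
  have two: "card (?S e) \<le> 2" if "e \<in> E" for e
  proof -
    obtain a b where e: "e = {a, b}"
      using E \<open>e \<in> E\<close> by (auto simp: vertex_pairs_def card_2_iff)
    have sub: "?S e \<subseteq> {(a, b), (b, a)}" by (auto simp: e doubleton_eq_iff)
    have "card (?S e) \<le> card {(a, b), (b, a)}" using card_mono[OF _ sub] by simp
    also have "\<dots> \<le> 2" using card_length[of "[(a, b), (b, a)]"] by simp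
    finally show ?thesis .
  qed
  have "card (\<Union>e\<in>E. ?S e) \<le> (\<Sum>e\<in>E. card (?S e))"
    by (rule card_UN_le[OF finE])
  also have "\<dots> \<le> (\<Sum>e\<in>E. 2)"
    by (rule sum_mono) (rule two)
  finally have card: "card (\<Union>e\<in>E. ?S e) \<le> 2 * card E" by simp
  have "mat_trace (?A * ?A) = (\<Sum>i<n. \<Sum>j<n. if {i, j} \<in> E then 1 else 0)"
    unfolding mat_trace_mult[OF A A]
    by (intro sum.cong refl) (auto simp: adjacency_mat_def insert_commute)
  also have "\<dots> = (\<Sum>x\<in>{..<n} \<times> {..<n}. if {fst x, snd x} \<in> E then 1 else 0)"
    by (simp add: sum.cartesian_product case_prod_unfold)
  also have "\<dots> = real (card {x \<in> {..<n} \<times> {..<n}. {fst x, snd x} \<in> E})"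
    by (simp add: sum.If_cases Int_def)
  also have "{x \<in> {..<n} \<times> {..<n}. {fst x, snd x} \<in> E} = (\<Union>e\<in>E. ?S e)"
    by auto
  finally show ?thesis using s_plus_le_trace[of n E] card by linarith
qed

section \<open>The number of edges\<close>

text \<open>The edge count is binomial with mean \<open>?N / 2\<close>; Hoeffding's inequality is
  applied with relative deviation \<open>1 / 16\<close>. The threshold \<open>9 / 16\<close> is the
  square of \<open>3 / 4\<close>, the value of \<open>(c - 1) / c\<close> at
  \<open>c = 4\<close>.\<close>

lemma prob_many_edges:
  assumes "n \<ge> 2"
  shows "measure_pmf.prob (random_graph n (1 / 2))
           {E. real (card E) \<ge> 9 / 16 * real (n choose 2)} \<le> exp (- real (n choose 2) / 128)"
proof -
  let ?N = "n choose 2"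
  interpret binomial_distribution ?N "1 / 2" by unfold_locales auto
  have N: "?N > 0" using assms by (simp add: zero_less_binomial_iff)
  have "map_pmf card (random_graph n (1 / 2)) = binomial_pmf ?N (1 / 2)"
    unfolding random_graph_def map_pmf_comp
    by (rule binomial_pmf_altdef'[symmetric])
      (simp_all add: finite_vertex_pairs card_vertex_pairs)
  from this[symmetric]
  have "measure_pmf.prob (random_graph n (1 / 2)) {E. real (card E) \<ge> 9 / 16 * real ?N} =
      measure_pmf.prob (binomial_pmf ?N (1 / 2)) {x. real x \<ge> 9 / 16 * real ?N}"
    by (simp add: vimage_def)
  also have "\<dots> = measure_pmf.prob (binomial_pmf ?N (1 / 2)) {x. x / ?N \<ge> 1 / 2 + 1 / 16}"
    using N by (intro arg_cong2[where f = measure] refl) (auto simp: field_simps)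
  also have "\<dots> \<le> exp (- 2 * ?N * (1 / 16)\<^sup>2)"
    by (rule prob_ge'[OF N]) simp
  also have "\<dots> = exp (- real ?N / 128)"
    by (simp add: power2_eq_square)
  finally show ?thesis .
qed

section \<open>Cliques through a vertex\<close>

lemma prob_pair_pmf_Times:
  "measure_pmf.prob (pair_pmf M N) (A \<times> B) = measure_pmf.prob M A * measure_pmf.prob N B"
proof -
  \<comment> \<open>The product rule applied below is for countable sets, so both factors are first
    cut down to the supports.\<close>
  have "measure_pmf.prob (pair_pmf M N) (A \<times> B) =
      measure_pmf.prob (pair_pmf M N) ((A \<inter> set_pmf M) \<times> (B \<inter> set_pmf N))"
    by (subst measure_Int_set_pmf[symmetric]) (simp add: Times_Int_Times)
  also have "\<dots> = measure_pmf.prob M (A \<inter> set_pmf M) * measure_pmf.prob N (B \<inter> set_pmf N)"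
    by (intro measure_pmf_prob_product) (auto intro: countable_Int2)
  finally show ?thesis by (simp add: measure_Int_set_pmf)
qed

text \<open>Disjoint blocks of coordinates are independent. The induction splits off the last block
  \<open>B m\<close> and continues on \<open>A - B m\<close>, hence the generalization over
  \<open>A\<close>.\<close>

lemma prob_no_block_all_True:
  fixes p :: real and B :: "nat \<Rightarrow> 'a set"
  assumes "finite A" "\<And>j. j < m \<Longrightarrow> B j \<subseteq> A"
    and "\<And>i j. i < j \<Longrightarrow> j < m \<Longrightarrow> B i \<inter> B j = {}" and p: "p \<in> {0..1}"
  shows "measure_pmf.prob (Pi_pmf A d (\<lambda>_. bernoulli_pmf p)) {f. \<forall>j<m. \<exists>e\<in>B j. \<not> f e} =
           (\<Prod>j<m. 1 - p ^ card (B j))"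
  using assms(1-3)
proof (induction m arbitrary: A)
  case (Suc m)
  let ?P = "\<lambda>A. Pi_pmf A d (\<lambda>_. bernoulli_pmf p)"
  let ?A' = "A - B m"
  have fin: "finite (B m)" using Suc.prems by (meson finite_subset lessI)
  have sub: "B j \<subseteq> ?A'" if "j < m" for j
    using Suc.prems(2)[of j] Suc.prems(3)[of j m] that by auto
  have "?P A = ?P (B m \<union> ?A')"
    using Suc.prems(2)[of m] by (simp add: Un_absorb1)
  also have "\<dots> = map_pmf (\<lambda>(f, g) x. if x \<in> B m then f x else g x)
      (pair_pmf (?P (B m)) (?P ?A'))"
    using fin Suc.prems(1) by (intro Pi_pmf_union) auto
  finally have "measure_pmf.prob (?P A) {f. \<forall>j<Suc m. \<exists>e\<in>B j. \<not> f e} =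
      measure_pmf.prob (pair_pmf (?P (B m)) (?P ?A'))
        ((\<lambda>(f, g) x. if x \<in> B m then f x else g x) -` {f. \<forall>j<Suc m. \<exists>e\<in>B j. \<not> f e})"
    by simp
  also have "(\<lambda>(f, g) x. if x \<in> B m then f x else g x) -` {f. \<forall>j<Suc m. \<exists>e\<in>B j. \<not> f e} =
      (- {f. \<forall>e\<in>B m. f e}) \<times> {g. \<forall>j<m. \<exists>e\<in>B j. \<not> g e}"
  proof -
    have "e \<notin> B m" if "j < m" "e \<in> B j" for j e
      using sub[OF that(1)] that(2) by auto
    hence *: "(\<exists>e\<in>B j. \<not> (if e \<in> B m then f e else g e)) \<longleftrightarrow> (\<exists>e\<in>B j. \<not> g e)"
      if "j < m" for j and f g :: "'a \<Rightarrow> bool"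
      using that by (intro bex_cong) auto
    show ?thesis by (simp add: set_eq_iff All_less_Suc * del: if_split cong: conj_cong)
  qed
  also have "measure_pmf.prob (pair_pmf (?P (B m)) (?P ?A')) \<dots> =
      measure_pmf.prob (?P (B m)) (- {f. \<forall>e\<in>B m. f e}) *
      measure_pmf.prob (?P ?A') {g. \<forall>j<m. \<exists>e\<in>B j. \<not> g e}"
    by (rule prob_pair_pmf_Times)
  also have "measure_pmf.prob (?P ?A') {g. \<forall>j<m. \<exists>e\<in>B j. \<not> g e} = (\<Prod>j<m. 1 - p ^ card (B j))"
    using Suc.prems sub by (intro Suc.IH) auto
  also have "measure_pmf.prob (?P (B m)) (- {f. \<forall>e\<in>B m. f e}) = 1 - p ^ card (B m)"
  proof -
    \<comment> \<open>Written as a product set, the event has the product of the coordinate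
      probabilities as its measure.\<close>
    have "measure_pmf.prob (?P (B m)) {f. \<forall>e\<in>B m. f e} =
        measure_pmf.prob (?P (B m)) (Pi (B m) (\<lambda>_. {True}))"
      by (intro arg_cong2[where f = measure] refl) auto
    also have "\<dots> = p ^ card (B m)"
      using fin p by (simp add: measure_Pi_pmf_Pi measure_pmf_single)
    finally show ?thesis
      using measure_pmf.prob_compl[of "{f. \<forall>e\<in>B m. f e}" "?P (B m)"]
      by (simp add: Compl_eq_Diff_UNIV)
  qed
  finally show ?case by (simp add: mult.commute)
qed simp

lemma clique_order_ge:
  assumes "is_clique n E K" "v \<in> K"
  shows "card K \<le> clique_order n E v"
proof -
  have "{card K | K. is_clique n E K \<and> v \<in> K} \<subseteq> card ` Pow {..<n}"
    by (auto simp: is_clique_def)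
  hence "finite {card K | K. is_clique n E K \<and> v \<in> K}"
    by (rule finite_subset) simp
  thus ?thesis
    unfolding clique_order_def by (rule Max_ge) (use assms in blast)
qed

text \<open>The sets \<open>K j\<close> are quadruples meeting only in \<open>v\<close>, so their
  sets \<open>B j\<close> of six pairs are disjoint. Each \<open>B j\<close> is fully present with
  probability \<open>1 / 64\<close>, independently, and if one is, \<open>v\<close> lies in a
  4-clique.\<close>

lemma prob_clique_order_less_4:
  assumes v: "v < n"
  shows "measure_pmf.prob (random_graph n (1 / 2)) {E. clique_order n E v < 4} \<le>
           (63 / 64) ^ ((n - 1) div 3)"
proof -
  \<comment> \<open>\<open>w\<close> enumerates the vertices while skipping \<open>v\<close>; its
    first \<open>n - 1\<close> values stay below \<open>n\<close>, which gives room for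
    \<open>(n - 1) div 3\<close> disjoint triples.\<close>
  define w where "w k = (if k < v then k else Suc k)" for k
  define K where "K j = {v, w (3 * j), w (3 * j + 1), w (3 * j + 2)}" for j
  define B where "B j = {e. e \<subseteq> K j \<and> card e = 2}" for j
  let ?m = "(n - 1) div 3"
  let ?P = "Pi_pmf (vertex_pairs n) False (\<lambda>_. bernoulli_pmf (1 / 2))"
  have w_eq: "w i = w j \<longleftrightarrow> i = j" "w i \<noteq> v" "v \<noteq> w i" for i j
    by (auto simp: w_def)
  have cardK: "card (K j) = 4" and finK: "finite (K j)" for j
    by (auto simp: K_def w_eq)
  have K_sub: "K j \<subseteq> {..<n}" if "j < ?m" for j
    using that v by (auto simp: K_def w_def)
  have K_Int: "K i \<inter> K j = {v}" if "i < j" for i j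
    using that by (auto simp: K_def w_eq)
  have cardB: "card (B j) = 6" for j
    using n_subsets[OF finK, of j 2] by (simp add: B_def cardK choose_two)
  have B_sub: "B j \<subseteq> vertex_pairs n" if "j < ?m" for j
    using K_sub[OF that] by (auto simp: B_def vertex_pairs_def)
  have B_disj: "B i \<inter> B j = {}" if "i < j" for i j
  proof -
    have False if "e \<in> B i" "e \<in> B j" for e
    proof -
      have "e \<subseteq> {v}" using that K_Int[OF \<open>i < j\<close>] by (auto simp: B_def)
      hence "card e \<le> 1" using card_mono[of "{v}" e] by simp
      thus False using that by (simp add: B_def)
    qed
    thus ?thesis by blast
  qed
  have no_clique: "\<forall>j<?m. \<exists>e\<in>B j. \<not> f e"
    if "clique_order n {e \<in> vertex_pairs n. f e} v < 4" for f
  proof (rule ccontr)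
    assume "\<not> ?thesis"
    then obtain j where j: "j < ?m" "\<forall>e\<in>B j. f e" by blast
    have "is_clique n {e \<in> vertex_pairs n. f e} (K j)"
      unfolding is_clique_def
    proof (intro conjI ballI impI K_sub[OF j(1)])
      fix a b assume "a \<in> K j" "b \<in> K j" "a \<noteq> b"
      hence "{a, b} \<in> B j" by (simp add: B_def)
      thus "{a, b} \<in> {e \<in> vertex_pairs n. f e}" using j B_sub[OF j(1)] by blast
    qed
    from clique_order_ge[OF this, of v] that show False by (simp add: cardK) (simp add: K_def)
  qed
  have "measure_pmf.prob (random_graph n (1 / 2)) {E. clique_order n E v < 4} =
      measure_pmf.prob ?P {f. clique_order n {e \<in> vertex_pairs n. f e} v < 4}"
    by (simp add: random_graph_def vimage_def)
  also have "\<dots> \<le> measure_pmf.prob ?P {f. \<forall>j<?m. \<exists>e\<in>B j. \<not> f e}"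
    using no_clique by (intro measure_pmf.finite_measure_mono) auto
  also have "\<dots> = (\<Prod>j<?m. 1 - (1 / 2) ^ card (B j))"
    by (intro prob_no_block_all_True finite_vertex_pairs B_sub B_disj) auto
  also have "\<dots> = (63 / 64) ^ ?m"
    by (simp add: cardB power_divide)
  finally show ?thesis .
qed

section \<open>The deterministic inequality and the limit\<close>

text \<open>Both sides are compared with \<open>3 / 4 * real n\<close>: twice the edge count is at
  most \<open>9 / 16 * n\<^sup>2\<close>, and each summand is at least \<open>3 / 4\<close> once the
  clique order is at least 4.\<close>

lemma sqrt_s_plus_le_clique_sum:
  assumes E: "E \<subseteq> vertex_pairs n" "real (card E) \<le> 9 / 16 * real (n choose 2)"
    and c: "\<And>v. v < n \<Longrightarrow> clique_order n E v \<ge> 4"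
  shows "sqrt (s_plus n E) \<le>
    (\<Sum>v<n. (real (clique_order n E v) - 1) / real (clique_order n E v))"
proof -
  have "2 * real (n choose 2) \<le> (real n)\<^sup>2"
  proof -
    have "2 * (n choose 2) \<le> n * (n - 1)"
      unfolding choose_two by (rule times_div_less_eq_dividend)
    also have "\<dots> \<le> n\<^sup>2" by (simp add: power2_eq_square)
    finally have "2 * (n choose 2) \<le> n\<^sup>2" .
    thus ?thesis by (metis of_nat_le_iff of_nat_mult of_nat_numeral of_nat_power)
  qed
  hence "s_plus n E \<le> (3 / 4 * real n)\<^sup>2"
    using s_plus_le_twice_edges[OF E(1)] E(2) by (simp add: power_mult_distrib power2_eq_square)
  hence "sqrt (s_plus n E) \<le> 3 / 4 * real n"
    by (intro real_le_lsqrt) auto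
  also have "\<dots> = (\<Sum>v<n. 3 / 4)" by simp
  also have "\<dots> \<le> (\<Sum>v<n. (real (clique_order n E v) - 1) / real (clique_order n E v))"
  proof (rule sum_mono)
    fix v assume "v \<in> {..<n}"
    with c[of v] show "3 / 4 \<le> (real (clique_order n E v) - 1) / real (clique_order n E v)"
      by (simp add: field_simps)
  qed
  finally show ?thesis .
qed

theorem theorem3p5:
  "(\<lambda>n. measure_pmf.prob (random_graph n (1 / 2))
      {E. sqrt (s_plus n E) \<le>
          (\<Sum>v<n. (real (clique_order n E v) - 1) / real (clique_order n E v))})
    \<longlonglongrightarrow> 1"
  (is "(\<lambda>n. measure_pmf.prob (?G n) (?S n)) \<longlonglongrightarrow> 1")
proof (rule tendsto_sandwich)
  \<comment> \<open>The two error terms bound the probability of too many edges and, by a union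
    bound over the vertices, that of some clique order below 4. A real exponent replaces
    \<open>(n - 1) div 3\<close> to make the limit amenable to \<open>real_asymp\<close>.\<close>
  let ?b = "\<lambda>n. 1 - exp (- (real n * (real n - 1)) / 256) -
    real n * (63 / 64) powr ((real n - 3) / 3)"
  show "?b \<longlonglongrightarrow> 1" by real_asymp
  show "\<forall>\<^sub>F n in sequentially. ?b n \<le> measure_pmf.prob (?G n) (?S n)"
  proof (rule eventually_sequentiallyI)
    fix n :: nat assume n: "n \<ge> 2"
    let ?X = "{E. real (card E) \<ge> 9 / 16 * real (n choose 2)}"
    let ?Y = "\<lambda>v. {E. clique_order n E v < 4}"
    have pairs: "set_pmf (?G n) \<subseteq> Pow (vertex_pairs n)"
      by (auto simp: random_graph_def)
    \<comment> \<open>Restricting to the support ensures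
      \<open>E \<subseteq> vertex_pairs n\<close>, which the deterministic inequality
      assumes.\<close>
    have sub: "- ?S n \<inter> set_pmf (?G n) \<subseteq> ?X \<union> (\<Union>v<n. ?Y v)"
    proof (intro subsetI)
      fix E assume E: "E \<in> - ?S n \<inter> set_pmf (?G n)"
      show "E \<in> ?X \<union> (\<Union>v<n. ?Y v)"
      proof (rule ccontr)
        assume "E \<notin> ?X \<union> (\<Union>v<n. ?Y v)"
        hence "real (card E) \<le> 9 / 16 * real (n choose 2)"
            "\<And>v. v < n \<Longrightarrow> 4 \<le> clique_order n E v"
          by (auto simp: not_less)
        from sqrt_s_plus_le_clique_sum[OF _ this] E pairs show False by blast
      qed
    qed
    have "n \<le> 3 * m + 3" if "m = (n - 1) div 3" for m
      using that by presburger
    hence "(real n - 3) / 3 \<le> real m" if "m = (n - 1) div 3" for m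
      using that by fastforce
    \<comment> \<open>The base is below 1, so lowering the exponent increases the power.\<close>
    hence q: "(63 / 64 :: real) ^ ((n - 1) div 3) \<le> (63 / 64) powr ((real n - 3) / 3)"
      by (subst powr_realpow[symmetric]) (auto intro: powr_mono')
    have N: "real (n choose 2) = real n * (real n - 1) / 2"
      using n by (simp add: choose_two real_of_nat_div of_nat_diff)
    have X: "measure_pmf.prob (?G n) ?X \<le> exp (- (real n * (real n - 1)) / 256)"
      using prob_many_edges[OF n] by (simp add: N)
    have "measure_pmf.prob (?G n) (\<Union>v<n. ?Y v) \<le> (\<Sum>v<n. measure_pmf.prob (?G n) (?Y v))"
      by (intro measure_pmf.finite_measure_subadditive_finite) auto
    also have "\<dots> \<le> (\<Sum>v<n. (63 / 64) powr ((real n - 3) / 3))"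
      by (intro sum_mono order.trans[OF prob_clique_order_less_4 q]) auto
    finally have Y: "measure_pmf.prob (?G n) (\<Union>v<n. ?Y v) \<le>
        real n * (63 / 64) powr ((real n - 3) / 3)"
      by simp
    have "1 - measure_pmf.prob (?G n) (?S n) = measure_pmf.prob (?G n) (- ?S n)"
      using measure_pmf.prob_compl[of "?S n" "?G n"] by (simp add: Compl_eq_Diff_UNIV)
    also have "\<dots> = measure_pmf.prob (?G n) (- ?S n \<inter> set_pmf (?G n))"
      by (rule measure_Int_set_pmf[symmetric])
    also have "\<dots> \<le> measure_pmf.prob (?G n) (?X \<union> (\<Union>v<n. ?Y v))"
      using sub by (intro measure_pmf.finite_measure_mono) auto
    also have "\<dots> \<le> measure_pmf.prob (?G n) ?X + measure_pmf.prob (?G n) (\<Union>v<n. ?Y v)"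
      by (intro measure_Un_le) auto
    finally show "?b n \<le> measure_pmf.prob (?G n) (?S n)" using X Y by linarith
  qed
qed auto

end
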